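(* Let $N=\{1,\dots,n\}$ and let $q\in\mathcal{Q}(N)$ be a sharing function such that $q(K,i)>0$ for all nonempty $K\subseteq N$ and all $i\in K$. Then for every game $v$ on $N$ and every integer $k$ with $2\le k\le n$, $$x^q(\mathsf{C}^k(v))=\mathsf{PI}(v),$$ where $x^q(\mathsf{C}^k(v))=\{x^q(\phi)\mid \phi\in \mathsf{C}^k(v)\}$. Consequently, for every game $v$ on $N$ and every $2\le k\le n$, $\mathsf{S}(\mathsf{C}^k(v))=\mathsf{PI}(v)$, where $\mathsf{S}(\mathsf{C}^k(v))=\bigcup_{\phi\in\mathsf{C}^k(v)}\mathsf{S}(\phi)$.
   Context: A game on $N=\{1,\dots,n\}$ is a function $v:2^N\to\mathbb{R}$ with $v(\emptyset)=0$. Its Möbius transform is $m^v(S)=\sum_{T\subseteq S}(-1)^{|S\setminus T|}v(T)$, so $v(S)=\sum_{T\subseteq S}m^v(T)$. $\mathcal{G}^k(N)$ is the set of at most $k$-additive games, i.e. games $\phi$ with $m^\phi(S)=0$ whenever $|S|>k$. The $k$-additive core of $v$ is $\mathsf{C}^k(v)=\{\phi\in\mathcal{G}^k(N)\mid \phi(S)\ge v(S)\ \forall S\subsetneq N,\ \phi(N)=v(N)\}$. For $x\in\mathbb{R}^n$, $x(S)=\sum_{i\in S}x_i$; the preimputation set is $\mathsf{PI}(v)=\{x\in\mathbb{R}^n\mid x(N)=v(N)\}$. A sharing function is a map $q:(2^N\setminus\{\emptyset\})\times N\to[0,1]$ with $q(K,i)=0$ if $i\notin K$ and $\sum_{i\in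 K}q(K,i)=1$ for all nonempty $K\subseteq N$; $\mathcal{Q}(N)$ is the set of sharing functions. The sharing value $x^q$ maps a game $\phi$ to the vector $x^q(\phi)\in\mathbb{R}^n$ with $x^q_i(\phi)=\sum_{S\ni i}q(S,i)m^\phi(S)$. The selectope of a game $\phi$ is $\mathsf{S}(\phi)=\{x^q(\phi)\mid q\in\mathcal{Q}(N)\}$. *)

theory Defs
  imports "HOL-Analysis.Finite_Cartesian_Product"
begin

text \<open>
  The player set $N$ is the universe of a finite type \<^typ>\<open>'n\<close>, so $n$ is
  \<^term>\<open>CARD('n)\<close>, a coalition is a value of type \<^typ>\<open>'n set\<close>, and $R^n$ is
  \<^typ>\<open>real ^ 'n\<close>.
\<close>

definition game :: "('n::finite set \<Rightarrow> real) \<Rightarrow> bool" where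
  "game v \<longleftrightarrow> v {} = 0"

definition moebius :: "('n::finite set \<Rightarrow> real) \<Rightarrow> 'n set \<Rightarrow> real" where
  "moebius v S = (\<Sum>T\<in>Pow S. (-1) ^ card (S - T) * v T)"

definition additive_games :: "nat \<Rightarrow> ('n::finite set \<Rightarrow> real) set" where
  "additive_games k = {\<phi>. game \<phi> \<and> (\<forall>S. card S > k \<longrightarrow> moebius \<phi> S = 0)}"

definition additive_core :: "nat \<Rightarrow> ('n::finite set \<Rightarrow> real) \<Rightarrow> ('n set \<Rightarrow> real) set" where
  "additive_core k v =
     {\<phi> \<in> additive_games k. (\<forall>S. S \<subset> UNIV \<longrightarrow> \<phi> S \<ge> v S) \<and> \<phi> UNIV = v UNIV}"

definition preimputations :: "('n::finite set \<Rightarrow> real) \<Rightarrow> (real ^ 'n) set" where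
  "preimputations v = {x. (\<Sum>i\<in>UNIV. x $ i) = v UNIV}"

text \<open>
  A sharing function is only defined on nonempty coalitions; the values \<open>q {} i\<close> of its
  total representation are left unconstrained and do not occur in \<open>sharing_value\<close>.
\<close>

definition sharing_functions :: "('n::finite set \<Rightarrow> 'n \<Rightarrow> real) set" where
  "sharing_functions =
     {q. \<forall>K. K \<noteq> {} \<longrightarrow>
           (\<forall>i. q K i \<in> {0..1}) \<and> (\<forall>i. i \<notin> K \<longrightarrow> q K i = 0) \<and> (\<Sum>i\<in>K. q K i) = 1}"

definition sharing_value ::
    "('n::finite set \<Rightarrow> 'n \<Rightarrow> real) \<Rightarrow> ('n set \<Rightarrow> real) \<Rightarrow> real ^ 'n" where
  "sharing_value q \<phi> = (\<chi> i. \<Sum>S\<in>{S. i \<in> S}. q S i * moebius \<phi> S)"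

definition selectope :: "('n::finite set \<Rightarrow> real) \<Rightarrow> (real ^ 'n) set" where
  "selectope \<phi> = {sharing_value q \<phi> | q. q \<in> sharing_functions}"

end

theory Submission imports Defs begin

text \<open>
  Write \<open>m\<close> for the Moebius transform of a game \<open>\<phi>\<close>. Since the dividend \<open>m T\<close> of a coalition
  \<open>T \<subseteq> S\<close> is shared out entirely within \<open>S\<close>, the difference between \<open>\<phi> S\<close> and the amount
  that the sharing value assigns to \<open>S\<close> only involves the coalitions \<open>T\<close> not contained in \<open>S\<close>:
  it equals minus the sum over these \<open>T\<close> of \<open>m T\<close> times the share of \<open>S \<inter> T\<close> in \<open>T\<close>.
  For \<open>S = N\<close> this is efficiency, whence every sharing value of a core element is a
  preimputation. Conversely, given a preimputation \<open>x\<close>, let \<open>m T = -t\<close> on all pairs, let \<open>m\<close>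
  vanish on larger coalitions, and choose \<open>m\<close> on singletons so that the sharing value is \<open>x\<close>.
  Every nonempty proper coalition \<open>S\<close> is crossed by a pair, so positivity of the shares gives
  \<open>\<phi> S - x(S) \<ge> c t\<close> with \<open>c > 0\<close>, and \<open>\<phi>\<close> lies in the core for large \<open>t\<close>.
\<close>

text \<open>Moebius inversion. As \<open>(-1) ^ card (T - U)\<close> splits into
  \<open>(-1) ^ card T\<close> and \<open>(-1) ^ card U\<close>, the transform is a signed
  alternating sum, to which symmetric inclusion-exclusion applies.\<close>

lemma sum_moebius:
  fixes \<phi> :: "'n::finite set \<Rightarrow> real"
  shows "(\<Sum>T\<in>Pow S. moebius \<phi> T) = \<phi> S"
proof -
  define g where "g S = (\<Sum>T\<in>Pow S. (-1) ^ card T * \<phi> T)" for S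
  have "moebius \<phi> T = (-1) ^ card T * g T" for T
  proof -
    have "(-1) ^ card (T - U) * \<phi> U = (-1) ^ card T * ((-1) ^ card U * \<phi> U)" if "U \<in> Pow T" for U
    proof -
      have "U \<subseteq> T" using that by simp
      then have "card T = card (T - U) + card U"
        by (simp add: card_Diff_subset card_mono)
      then show ?thesis
        by (simp add: power_add flip: power_mult_distrib mult.assoc)
    qed
    then show ?thesis
      unfolding moebius_def g_def sum_distrib_left by (rule sum.cong[OF refl])
  qed
  moreover have "\<phi> S = (\<Sum>T\<in>Pow S. (-1) ^ card T * g T)"
    by (rule inclusion_exclusion_symmetric) (simp_all add: g_def)
  ultimately show ?thesis by simp
qed

text \<open>The converse inversion: it allows a game to be built by prescribing its dividends
  freely.\<close>

lemma moebius_sum_Pow: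
  fixes \<mu> :: "'n::finite set \<Rightarrow> real"
  shows "moebius (\<lambda>S. \<Sum>T\<in>Pow S. \<mu> T) = \<mu>"
proof
  fix S :: "'n set"
  have "\<mu> S = (\<Sum>T\<in>Pow S. (-1) ^ (card S - card T) * (\<Sum>U\<in>Pow T. \<mu> U))"
    by (rule inclusion_exclusion_mobius) simp_all
  also have "\<dots> = moebius (\<lambda>S. \<Sum>T\<in>Pow S. \<mu> T) S"
    unfolding moebius_def by (intro sum.cong refl) (simp add: card_Diff_subset)
  finally show "moebius (\<lambda>S. \<Sum>T\<in>Pow S. \<mu> T) S = \<mu> S" ..
qed

lemma moebius_empty: "moebius \<phi> {} = \<phi> {}"
  by (simp add: moebius_def)

lemma sum_sharing_function:
  assumes "q \<in> sharing_functions" "K \<noteq> {}" "K \<subseteq> S"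
  shows "(\<Sum>i\<in>S \<inter> K. q K i) = 1"
proof -
  have "S \<inter> K = K" using assms(3) by blast
  then show ?thesis using assms by (simp add: sharing_functions_def)
qed

lemma sum_sharing_value:
  fixes \<phi> :: "'n::finite set \<Rightarrow> real"
  shows "(\<Sum>i\<in>S. sharing_value q \<phi> $ i) = (\<Sum>T\<in>UNIV. moebius \<phi> T * (\<Sum>i\<in>S \<inter> T. q T i))"
proof -
  have "(\<Sum>i\<in>S. sharing_value q \<phi> $ i)
      = (\<Sum>i\<in>S. \<Sum>T\<in>UNIV. if i \<in> T then q T i * moebius \<phi> T else 0)"
    by (simp add: sharing_value_def sum.If_cases)
  also have "\<dots> = (\<Sum>T\<in>UNIV. \<Sum>i\<in>S. if i \<in> T then q T i * moebius \<phi> T else 0)"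
    by (rule sum.swap)
  also have "\<dots> = (\<Sum>T\<in>UNIV. moebius \<phi> T * (\<Sum>i\<in>S \<inter> T. q T i))"
    by (simp add: sum.inter_restrict sum_distrib_left mult.commute if_distrib cong: if_cong)
  finally show ?thesis .
qed

lemma game_eq_sharing_value:
  fixes \<phi> :: "'n::finite set \<Rightarrow> real"
  assumes "q \<in> sharing_functions" "game \<phi>"
  shows "\<phi> S = (\<Sum>i\<in>S. sharing_value q \<phi> $ i)
           - (\<Sum>T\<in>- Pow S. moebius \<phi> T * (\<Sum>i\<in>S \<inter> T. q T i))"
proof -
  \<comment> \<open>The values \<open>q {} i\<close> are arbitrary and the sum over the empty
    coalition is 0, not 1, so the term of \<open>{}\<close> needs a zero dividend.\<close>
  have m0: "moebius \<phi> {} = 0"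
    using assms(2) by (simp add: moebius_empty game_def)
  have "(\<Sum>T\<in>Pow S. moebius \<phi> T * (\<Sum>i\<in>S \<inter> T. q T i)) = (\<Sum>T\<in>Pow S. moebius \<phi> T)"
  proof (intro sum.cong refl)
    fix T assume "T \<in> Pow S"
    then show "moebius \<phi> T * (\<Sum>i\<in>S \<inter> T. q T i) = moebius \<phi> T"
      using sum_sharing_function[OF assms(1), of T S] m0 by (cases "T = {}") auto
  qed
  moreover have "(\<Sum>T\<in>UNIV. moebius \<phi> T * (\<Sum>i\<in>S \<inter> T. q T i))
      = (\<Sum>T\<in>Pow S. moebius \<phi> T * (\<Sum>i\<in>S \<inter> T. q T i))
      + (\<Sum>T\<in>- Pow S. moebius \<phi> T * (\<Sum>i\<in>S \<inter> T. q T i))"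
    using sum.subset_diff[of "Pow S" UNIV "\<lambda>T. moebius \<phi> T * (\<Sum>i\<in>S \<inter> T. q T i)"]
    by (simp add: Compl_eq_Diff_UNIV)
  ultimately show ?thesis
    by (simp add: sum_sharing_value sum_moebius)
qed

lemma sharing_value_in_preimputations:
  fixes v :: "'n::finite set \<Rightarrow> real"
  assumes "q \<in> sharing_functions" "\<phi> \<in> additive_core k v"
  shows "sharing_value q \<phi> \<in> preimputations v"
proof -
  have "game \<phi>" "\<phi> UNIV = v UNIV"
    using assms(2) by (auto simp: additive_core_def additive_games_def)
  then show ?thesis
    using game_eq_sharing_value[OF assms(1), of \<phi> UNIV] by (simp add: preimputations_def)
qed

lemma preimputation_is_sharing_value:
  fixes v :: "'n::finite set \<Rightarrow> real"
  assumes q: "q \<in> sharing_functions" and pos: "\<And>K i. K \<noteq> {} \<Longrightarrow> i \<in> K \<Longrightarrow> q K i > 0"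
    and v: "game v" and k: "2 \<le> k" and x: "x \<in> preimputations v"
  shows "x \<in> sharing_value q ` additive_core k v"
proof -
  \<comment> \<open>One \<open>t\<close> must serve all coalitions and crossing pairs. The sum of
    all these quotients bounds each of them, since the absolute values make every term nonnegative,
    even for the unconstrained \<open>q {} i\<close>.\<close>
  define r where "r = (\<lambda>(S, T, i). \<bar>v S - (\<Sum>j\<in>S. x $ j)\<bar> / \<bar>q T i\<bar>)"
  define t where "t = (\<Sum>p\<in>UNIV. r p)"
  have r_le: "r p \<le> t" for p
    unfolding t_def by (rule member_le_sum) (auto simp: r_def)
  have t0: "t \<ge> 0"
    unfolding t_def by (rule sum_nonneg) (auto simp: r_def)
  \<comment> \<open>The added sum offsets the \<open>- t\<close> that player \<open>i\<close> shares
    in every pair containing \<open>i\<close>.\<close>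
  define a where "a i = x $ i + t * (\<Sum>S | i \<in> S \<and> card S = 2. q S i)" for i
  define \<mu> where "\<mu> T = (if card T = 1 then a (the_elem T) else if card T = 2 then - t else 0)" for T
  define \<phi> where "\<phi> S = (\<Sum>T\<in>Pow S. \<mu> T)" for S
  have m: "moebius \<phi> = \<mu>"
    unfolding \<phi>_def by (rule moebius_sum_Pow)
  have gm: "game \<phi>"
    by (simp add: game_def \<phi>_def \<mu>_def)
  have sv: "sharing_value q \<phi> = x"
  proof (rule vec_eq_iff[THEN iffD2], rule allI)
    fix i
    have q1: "q {i} i = 1"
      using sum_sharing_function[OF q, of "{i}" "{i}"] by simp
    have "sharing_value q \<phi> $ i = (\<Sum>S | i \<in> S. q S i * \<mu> S)"
      by (simp add: sharing_value_def m)
    also have "\<dots> = a i + (\<Sum>S\<in>{S. i \<in> S} - {{i}}. q S i * \<mu> S)"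
      by (subst sum.remove[where x = "{i}"]) (simp_all add: \<mu>_def q1)
    also have "(\<Sum>S\<in>{S. i \<in> S} - {{i}}. q S i * \<mu> S) = (\<Sum>S | i \<in> S \<and> card S = 2. q S i * \<mu> S)"
      by (rule sum.mono_neutral_right) (auto simp: \<mu>_def card_1_singleton_iff)
    also have "\<dots> = - t * (\<Sum>S | i \<in> S \<and> card S = 2. q S i)"
      by (simp add: sum_distrib_left \<mu>_def mult.commute sum_negf)
    finally show "sharing_value q \<phi> $ i = x $ i"
      by (simp add: a_def)
  qed
  have ge: "\<phi> S \<ge> v S" if "S \<subset> UNIV" for S
  proof (cases "S = {}")
    case True
    then show ?thesis using gm v by (simp add: game_def)
  next
    case False
    then obtain i j where i: "i \<in> S" and j: "j \<notin> S" using \<open>S \<subset> UNIV\<close> by blast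
    define D where "D T = - (\<mu> T * (\<Sum>l\<in>S \<inter> T. q T l))" for T
    have share: "(\<Sum>l\<in>S \<inter> T. q T l) \<ge> 0" for T
    proof (rule sum_nonneg)
      fix l assume "l \<in> S \<inter> T"
      then have "q T l > 0" by (intro pos) auto
      then show "q T l \<ge> 0" by simp
    qed
    \<comment> \<open>The sign of \<open>a\<close> is unknown, but a singleton not contained in
      \<open>S\<close> is disjoint from \<open>S\<close>; all other dividends are \<open>- t\<close>
      or 0.\<close>
    have D0: "D T \<ge> 0" if "T \<in> - Pow S" for T
    proof (cases "card T = 1")
      case True
      then obtain l where "T = {l}" by (auto simp: card_1_singleton_iff)
      then have "S \<inter> T = {}" using that by auto
      then show ?thesis by (simp add: D_def)
    next
      case False
      then show ?thesis using share[of T] t0 by (simp add: D_def \<mu>_def)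
    qed
    have "i \<noteq> j" using i j by blast
    then have D_pair: "D {i, j} = t * q {i, j} i"
      using i j by (simp add: D_def \<mu>_def)
    have qp: "q {i, j} i > 0" by (rule pos) auto
    have "\<bar>v S - (\<Sum>j\<in>S. x $ j)\<bar> / q {i, j} i \<le> t"
      using r_le[of "(S, {i, j}, i)"] qp by (simp add: r_def)
    then have "v S - (\<Sum>j\<in>S. x $ j) \<le> D {i, j}"
      using qp by (simp add: D_pair field_simps)
    also have "\<dots> \<le> (\<Sum>T\<in>- Pow S. D T)"
      by (rule member_le_sum) (use j D0 in auto)
    also have "\<dots> = \<phi> S - (\<Sum>j\<in>S. x $ j)"
      using game_eq_sharing_value[OF q gm, of S] by (simp add: sv m D_def sum_negf)
    finally show ?thesis by simp
  qed
  have "\<phi> UNIV = v UNIV"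
    using game_eq_sharing_value[OF q gm, of UNIV] x by (simp add: sv preimputations_def)
  \<comment> \<open>Here \<open>2 \<le> k\<close> makes pairs admissible.\<close>
  moreover have "\<mu> S = 0" if "card S > k" for S
    using that k by (simp add: \<mu>_def)
  ultimately have "\<phi> \<in> additive_core k v"
    using gm ge m by (simp add: additive_core_def additive_games_def)
  then show ?thesis using sv by blast
qed

text \<open>Equal shares are positive on every coalition, so a single sharing function already makes
  the selectopes cover all preimputations.\<close>

lemma uniform_sharing_function:
  "(\<lambda>K i. if i \<in> K then 1 / real (card K) else 0) \<in> (sharing_functions :: ('n::finite set \<Rightarrow> 'n \<Rightarrow> real) set)"
  by (auto simp: sharing_functions_def Suc_le_eq card_gt_0_iff)

theorem theorem1:
  shows "(\<forall>q :: 'n::finite set \<Rightarrow> 'n \<Rightarrow> real.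
            q \<in> sharing_functions \<longrightarrow> (\<forall>K i. K \<noteq> {} \<longrightarrow> i \<in> K \<longrightarrow> q K i > 0) \<longrightarrow>
            (\<forall>v k. game v \<longrightarrow> 2 \<le> k \<longrightarrow> k \<le> CARD('n) \<longrightarrow>
               sharing_value q ` additive_core k v = preimputations v))
       \<and> (\<forall>(v :: 'n set \<Rightarrow> real) k. game v \<longrightarrow> 2 \<le> k \<longrightarrow> k \<le> CARD('n) \<longrightarrow>
            (\<Union>\<phi>\<in>additive_core k v. selectope \<phi>) = preimputations v)"
proof (intro conjI allI impI)
  fix q :: "'n set \<Rightarrow> 'n \<Rightarrow> real" and v :: "'n set \<Rightarrow> real" and k :: nat
  assume "q \<in> sharing_functions" "\<forall>K i. K \<noteq> {} \<longrightarrow> i \<in> K \<longrightarrow> q K i > 0" "game v" "2 \<le> k"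
  then show "sharing_value q ` additive_core k v = preimputations v"
    using sharing_value_in_preimputations[of q _ k v] preimputation_is_sharing_value[of q v k]
    by blast
next
  fix v :: "'n set \<Rightarrow> real" and k :: nat
  assume v: "game v" and k: "2 \<le> k"
  let ?u = "\<lambda>(K :: 'n set) i. if i \<in> K then 1 / real (card K) else 0"
  have "preimputations v \<subseteq> sharing_value ?u ` additive_core k v"
    using preimputation_is_sharing_value[OF uniform_sharing_function _ v k]
    by (auto simp: card_gt_0_iff)
  then show "(\<Union>\<phi>\<in>additive_core k v. selectope \<phi>) = preimputations v"
    using sharing_value_in_preimputations[of _ _ k v] uniform_sharing_function
    unfolding selectope_def by blast
qed

end
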